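(* Let $\mathcal{I}$ (students) and $\mathcal{J}$ (schools) be finite sets with $|\mathcal{J}|\le|\mathcal{I}|$. Let each school $j\in\mathcal{J}$ have a capacity $q_j\in\{0,1,2,\dots\}$, and let $(u_{ij})_{i\in\mathcal{I},\,j\in\mathcal{J}}$ be real numbers such that $u_{ij}>0$ for all $i,j$, and such that there are no indifferences: $u_{ij}\neq u_{i'j}$ for all $j\in\mathcal{J}$ and distinct $i,i'\in\mathcal{I}$, and $u_{ij}\neq u_{ij'}$ for all $i\in\mathcal{I}$ and distinct $j,j'\in\mathcal{J}$. The utility of student $i$ at school $j$ is $u_{ij}$, the utility of school $j$ matched with a set $I\subseteq\mathcal{I}$ is $v_{jI}=\sum_{i\in I}u_{ij}$, and an unassigned student has utility $-\infty$. Let $\mu^{MML}$ be an allocation produced by the max-max-lex algorithm (defined in the context). Then: (a) $\mu^{MML}$ maximizes, among all feasible allocations, the vector of rank-ordered utilities in the lexicographic order starting from the highest utility. That is, for a feasible allocation $\mu$ let $U^{\downarrow}(\mu)\in(\mathbb{R}\cup\{-\infty\})^{|\mathcal{I}|}$ be the vector $(u_{i\mu(i)})_{i\in\mathcal{I}}$ rearranged in non-increasing order; then for every feasible allocation $\mu$, $U^{\downarrow}(\mu^{MML})$ is greater than or equal to $U^{\downarrow}(\mu)$ in the lexicographic order (largest entry compared first). (b) $\mu^{MML}$ is stable. (c) The stable allocation is unique: there is exactly one stable feasible allocation.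
   Context: Allocations. An allocation $\mu$ assigns to each student $i\in\mathcal{I}$ either a school $\mu(i)\in\mathcal{J}$ or $\mu(i)=i$ (meaning $i$ is unassigned). For a school $j$, write $\mu(j)=\{i\in\mathcal{I}:\mu(i)=j\}$ for the set of students assigned to $j$. The allocation is feasible if each student is assigned to at most one school (automatic in this notation) and $|\mu(j)|\le q_j$ for every $j\in\mathcal{J}$. Convention: $u_{i\mu(i)}=-\infty$ if $\mu(i)=i$, and $-\infty$ is smaller than every real number. Stability. A feasible allocation $\mu$ is stable if there is no pair $(i,j)\in\mathcal{I}\times\mathcal{J}$ such that $u_{ij}>u_{i\mu(i)}$ and either $|\mu(j)|<q_j$, or $|\mu(j)|=q_j$ and there exists $i'\in\mu(j)$ with $u_{i'j}<u_{ij}$. Max-max-lex algorithm. Initialize $t=0$, $I^0=\mathcal{I}$, $q^0=q=(q_j)_{j\in\mathcal{J}}$. While $I^t\neq\emptyset$ and $q^t\neq 0$: choose a pair $(i^t,j^t)$ maximizing $u_{ij}$ over all $i\in I^t$ and all $j\in\mathcal{J}$ with $q^t_j\neq 0$; set $\mu(i^t)=j^t$; set $q^{t+1}=q^t-e^{j^t}$, where $e^{j}$ is the $j$-th canonical basis vector of $\mathbb{R}^{\mathcal{J}}$; set $I^{t+1}=I^t\setminus\{i^t\}$; increase $t$ by $1$. When the loop ends, every student not assigned during the loop is unassigned ($\mu(i)=i$). *)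

theory Defs
  imports "HOL-Library.Extended_Real" "HOL-Library.Multiset"
begin

text \<open>
  An allocation is a map from students to schools, where None stands for "unassigned"
  (written mu(i) = i in the literature). Feasible allocations are None outside the set I of students, so that
  equality of allocations is equality of functions.
\<close>

definition assigned :: "'i set \<Rightarrow> ('i \<rightharpoonup> 'j) \<Rightarrow> 'j \<Rightarrow> 'i set" where
  "assigned I \<mu> j = {i \<in> I. \<mu> i = Some j}"

definition feasible :: "'i set \<Rightarrow> 'j set \<Rightarrow> ('j \<Rightarrow> nat) \<Rightarrow> ('i \<rightharpoonup> 'j) \<Rightarrow> bool" where
  "feasible I J q \<mu> \<longleftrightarrow>
     dom \<mu> \<subseteq> I \<and> ran \<mu> \<subseteq> J \<and> (\<forall>j\<in>J. card (assigned I \<mu> j) \<le> q j)"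

definition utility :: "('i \<Rightarrow> 'j \<Rightarrow> real) \<Rightarrow> ('i \<rightharpoonup> 'j) \<Rightarrow> 'i \<Rightarrow> ereal" where
  "utility u \<mu> i = (case \<mu> i of None \<Rightarrow> -\<infinity> | Some j \<Rightarrow> ereal (u i j))"

definition stable_allocation ::
  "'i set \<Rightarrow> 'j set \<Rightarrow> ('j \<Rightarrow> nat) \<Rightarrow> ('i \<Rightarrow> 'j \<Rightarrow> real) \<Rightarrow> ('i \<rightharpoonup> 'j) \<Rightarrow> bool" where
  "stable_allocation I J q u \<mu> \<longleftrightarrow>
     feasible I J q \<mu> \<and>
     \<not> (\<exists>i\<in>I. \<exists>j\<in>J. ereal (u i j) > utility u \<mu> i \<and>
          (card (assigned I \<mu> j) < q j \<or>
           card (assigned I \<mu> j) = q j \<and> (\<exists>i'\<in>assigned I \<mu> j. u i' j < u i j)))"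

definition ranked_utilities ::
  "'i set \<Rightarrow> ('i \<Rightarrow> 'j \<Rightarrow> real) \<Rightarrow> ('i \<rightharpoonup> 'j) \<Rightarrow> ereal list" where
  "ranked_utilities I u \<mu> =
     rev (sorted_list_of_multiset (image_mset (utility u \<mu>) (mset_set I)))"

text \<open>
  All lists compared here have length card I, so the convention of lexordp_eq on
  proper prefixes plays no role.
\<close>

definition lex_maximal ::
  "'i set \<Rightarrow> 'j set \<Rightarrow> ('j \<Rightarrow> nat) \<Rightarrow> ('i \<Rightarrow> 'j \<Rightarrow> real) \<Rightarrow> ('i \<rightharpoonup> 'j) \<Rightarrow> bool" where
  "lex_maximal I J q u \<mu> \<longleftrightarrow>
     feasible I J q \<mu> \<and>
     (\<forall>\<nu>. feasible I J q \<nu> \<longrightarrow>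
        ord_class.lexordp_eq (ranked_utilities I u \<nu>) (ranked_utilities I u \<mu>))"

text \<open>
  Reachable states of the max-max-lex algorithm: remaining students R, remaining capacities c,
  assignments made so far. It is a relation because the maximizing pair need not be unique: ties
  between pairs that differ in both the student and the school are not excluded.
  The conditions on (i, j) imply the loop guard.
\<close>

inductive mml_reachable ::
  "'i set \<Rightarrow> 'j set \<Rightarrow> ('j \<Rightarrow> nat) \<Rightarrow> ('i \<Rightarrow> 'j \<Rightarrow> real) \<Rightarrow>
   'i set \<Rightarrow> ('j \<Rightarrow> nat) \<Rightarrow> ('i \<rightharpoonup> 'j) \<Rightarrow> bool"
  for I J q u where
  init: "mml_reachable I J q u I q Map.empty"
| step: "\<lbrakk>mml_reachable I J q u R c \<mu>; i \<in> R; j \<in> J; c j \<noteq> 0;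
          \<And>i' j'. \<lbrakk>i' \<in> R; j' \<in> J; c j' \<noteq> 0\<rbrakk> \<Longrightarrow> u i' j' \<le> u i j\<rbrakk>
         \<Longrightarrow> mml_reachable I J q u (R - {i}) (c(j := c j - 1)) (\<mu>(i \<mapsto> j))"

definition mml_output ::
  "'i set \<Rightarrow> 'j set \<Rightarrow> ('j \<Rightarrow> nat) \<Rightarrow> ('i \<Rightarrow> 'j \<Rightarrow> real) \<Rightarrow> ('i \<rightharpoonup> 'j) \<Rightarrow> bool" where
  "mml_output I J q u \<mu> \<longleftrightarrow>
     (\<exists>R c. mml_reachable I J q u R c \<mu> \<and> (R = {} \<or> (\<forall>j\<in>J. c j = 0)))"

lemma mml_output_from_reachable:
  assumes "finite R" "finite J" "mml_reachable I J q u R c \<mu>"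
  shows "\<exists>\<nu>. mml_output I J q u \<nu>"
  using assms(1,3)
proof (induction "card R" arbitrary: R c \<mu> rule: less_induct)
  case less
  show ?case
  proof (cases "R = {} \<or> (\<forall>j\<in>J. c j = 0)")
    case True
    then show ?thesis using less.prems unfolding mml_output_def by blast
  next
    case False
    define P where "P = R \<times> {j\<in>J. c j \<noteq> 0}"
    have "finite P" "P \<noteq> {}"
      using False less.prems(1) assms(2) by (auto simp: P_def)
    then have "Max (case_prod u ` P) \<in> case_prod u ` P" by simp
    then obtain p where "p \<in> P" and m: "Max (case_prod u ` P) = case_prod u p" by blast
    with \<open>finite P\<close> have p: "p \<in> P" "\<And>p'. p' \<in> P \<Longrightarrow> case_prod u p' \<le> case_prod u p"
      by (simp, metis Max_ge finite_imageI imageI)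
    obtain i j where ij: "p = (i, j)" by (cases p)
    have mem: "i \<in> R" "j \<in> J" "c j \<noteq> 0" using p(1) by (auto simp: ij P_def)
    have "u i' j' \<le> u i j" if "i' \<in> R" "j' \<in> J" "c j' \<noteq> 0" for i' j'
      using p(2)[of "(i', j')"] that by (auto simp: ij P_def)
    then have "mml_reachable I J q u (R - {i}) (c(j := c j - 1)) (\<mu>(i \<mapsto> j))"
      using mml_reachable.step[OF less.prems(2) mem] by blast
    moreover have "card (R - {i}) < card R"
      using less.prems(1) mem(1) by (rule card_Diff1_less)
    ultimately show ?thesis using less.hyps less.prems(1) by blast
  qed
qed

lemma mml_output_exists:
  assumes "finite I" "finite J"
  shows "\<exists>\<mu>. mml_output I J q u \<mu>"
  using mml_output_from_reachable[OF assms mml_reachable.init] .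

end

theory Submission imports Defs
begin

text \<open>
  Moving a blocking pair together, at the expense of the dropped student if there is one, raises
  one entry of the utility vector above all the others that change, so a lexicographically
  maximal allocation is stable. Two distinct stable allocations would have a pair of largest
  utility on which they differ; that pair blocks the allocation that lacks it. Hence there is
  exactly one stable allocation, it is the lexicographic maximum, and it is the output of the
  algorithm because that output is stable.
\<close>

section \<open>Lexicographic comparison of ranked utility vectors\<close>

text \<open>Two descending lists with the same multiplicities above \<open>x\<close> agree until the
  block of \<open>x\<close>. That block is longer in \<open>ys\<close>, so where \<open>ys\<close>
  still shows \<open>x\<close>, \<open>xs\<close> has a smaller entry or has ended. Comparing sorted
  vectors thus reduces to counting.\<close>

lemma lexordp_desc_if_count_less:
  fixes xs ys :: "'a::linorder list"
  assumes "sorted_wrt (\<ge>) xs" "sorted_wrt (\<ge>) ys"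
    and "count (mset xs) x < count (mset ys) x"
    and "\<And>y. x < y \<Longrightarrow> count (mset xs) y = count (mset ys) y"
  shows "ord_class.lexordp xs ys"
  using assms
proof (induction xs arbitrary: ys)
  case Nil
  then show ?case by (cases ys) auto
next
  case (Cons a xs)
  from Cons.prems(3) have x: "x \<in># mset ys"
    by (metis count_greater_zero_iff gr_zeroI not_less_zero)
  then obtain b ys' where ys: "ys = b # ys'" by (cases ys) auto
  have xb: "x \<le> b" using x Cons.prems(2) by (auto simp: ys)
  consider "a < b" | "a = b" | "b < a" by fastforce
  then show ?case
  proof cases
    case 1
    then show ?thesis by (simp add: ys)
  next
    case 2
    have "ord_class.lexordp xs ys'"
    proof (rule Cons.IH)
      show "count (mset xs) x < count (mset ys') x"
        using Cons.prems(3) by (simp add: ys 2 split: if_splits)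
      show "count (mset xs) y = count (mset ys') y" if "x < y" for y
        using Cons.prems(4)[OF that] by (simp add: ys 2 split: if_splits)
    qed (use Cons.prems in \<open>auto simp: ys\<close>)
    then show ?thesis by (simp add: ys 2)
  next
    case 3
    \<comment> \<open>No entry of \<open>ys\<close> exceeds its head \<open>b\<close>, so
      \<open>a\<close> would occur in \<open>xs\<close> only, although \<open>x < a\<close> forces
      equal multiplicities.\<close>
    have "a \<notin># mset ys" using 3 Cons.prems(2) by (force simp: ys)
    then have "count (mset ys) a = 0" by (simp add: not_in_iff)
    moreover have "x < a" using xb 3 by simp
    ultimately show ?thesis using Cons.prems(4)[of a]
      by (metis count_eq_zero_iff list.set_intros(1) set_mset_mset)
  qed
qed

text \<open>The threshold is the new utility of \<open>i\<close>. Every other student whose utility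
  changes was below it and stays below it, so multiplicities above the threshold are kept while the
  one at the threshold grows.\<close>

lemma ranked_utilities_less:
  assumes "finite I" "i \<in> I" "utility u \<mu> i < utility u \<nu> i"
    and other: "\<And>k. \<lbrakk>k \<in> I; k \<noteq> i\<rbrakk> \<Longrightarrow> utility u \<nu> k = utility u \<mu> k \<or>
      utility u \<mu> k < utility u \<nu> i \<and> utility u \<nu> k < utility u \<nu> i"
  shows "ord_class.lexordp (ranked_utilities I u \<mu>) (ranked_utilities I u \<nu>)"
proof (rule lexordp_desc_if_count_less)
  let ?x = "utility u \<nu> i"
  have cnt: "count (mset (ranked_utilities I u \<mu>)) y = card {k \<in> I. utility u \<mu> k = y}" for \<mu> y
  proof -
    have "count (mset (ranked_utilities I u \<mu>)) y =
        (\<Sum>k | k \<in> I \<and> y = utility u \<mu> k. count (mset_set I) k)"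
      using assms(1) by (simp add: ranked_utilities_def count_image_mset')
    also have "\<dots> = (\<Sum>k | k \<in> I \<and> y = utility u \<mu> k. 1)"
      using assms(1) by (intro sum.cong) auto
    also have "\<dots> = card {k \<in> I. utility u \<mu> k = y}" by (simp add: eq_commute)
    finally show ?thesis .
  qed
  have desc: "sorted_wrt (\<ge>) (ranked_utilities I u \<mu>)" for \<mu>
    using sorted_sorted_list_of_multiset[of "image_mset (utility u \<mu>) (mset_set I)"]
    by (simp add: ranked_utilities_def sorted_wrt_rev)
  show "sorted_wrt (\<ge>) (ranked_utilities I u \<mu>)" "sorted_wrt (\<ge>) (ranked_utilities I u \<nu>)"
    by (fact desc)+
  \<comment> \<open>A student already at \<open>?x\<close> cannot be one whose utility changes;
    \<open>i\<close> itself makes the inclusion strict.\<close>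
  have "{k \<in> I. utility u \<mu> k = ?x} \<subset> {k \<in> I. utility u \<nu> k = ?x}"
  proof
    show "{k \<in> I. utility u \<mu> k = ?x} \<subseteq> {k \<in> I. utility u \<nu> k = ?x}"
      using assms(3) other by force
    show "{k \<in> I. utility u \<mu> k = ?x} \<noteq> {k \<in> I. utility u \<nu> k = ?x}"
      using assms(2,3) by force
  qed
  then show "count (mset (ranked_utilities I u \<mu>)) ?x < count (mset (ranked_utilities I u \<nu>)) ?x"
    unfolding cnt using assms(1) by (intro psubset_card_mono) auto
  show "count (mset (ranked_utilities I u \<mu>)) y = count (mset (ranked_utilities I u \<nu>)) y"
    if "?x < y" for y
  proof -
    have "utility u \<mu> k = y \<longleftrightarrow> utility u \<nu> k = y" if "k \<in> I" for k
      using other[of k] assms(3) \<open>?x < y\<close> that by (cases "k = i") auto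
    then have "{k \<in> I. utility u \<mu> k = y} = {k \<in> I. utility u \<nu> k = y}" by blast
    then show ?thesis unfolding cnt by simp
  qed
qed

text \<open>The set \<open>D\<close> of dropped students lets one lemma cover both kinds of blocking pair.\<close>

lemma feasible_improvement:
  assumes "finite I" "feasible I J q \<mu>" "i \<in> I" "j \<in> J" "utility u \<mu> i < ereal (u i j)"
    and D: "D \<subseteq> assigned I \<mu> j" "\<And>k. k \<in> D \<Longrightarrow> u k j < u i j"
    and room: "card (assigned I \<mu> j - D) < q j"
  obtains \<nu> where "feasible I J q \<nu>"
    "ord_class.lexordp (ranked_utilities I u \<mu>) (ranked_utilities I u \<nu>)"
proof
  \<comment> \<open>Restricting to \<open>- D\<close> unassigns the dropped students; the update
    seats \<open>i\<close> at \<open>j\<close> and also vacates any seat that \<open>i\<close> held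
    before.\<close>
  define \<nu> where "\<nu> = (\<mu> |` (- D))(i \<mapsto> j)"
  have fin: "finite (assigned I \<mu> k)" for k
    using assms(1) by (simp add: assigned_def)
  show "feasible I J q \<nu>"
    unfolding feasible_def
  proof (intro conjI ballI)
    show "dom \<nu> \<subseteq> I" "ran \<nu> \<subseteq> J"
      using assms(2-4) by (auto simp: feasible_def \<nu>_def restrict_map_def ran_def split: if_splits)
    fix k assume k: "k \<in> J"
    show "card (assigned I \<nu> k) \<le> q k"
    proof (cases "k = j")
      case True
      have "assigned I \<nu> j \<subseteq> insert i (assigned I \<mu> j - D)"
        by (auto simp: assigned_def \<nu>_def restrict_map_def split: if_splits)
      then have "card (assigned I \<nu> j) \<le> card (insert i (assigned I \<mu> j - D))"
        using fin by (intro card_mono) auto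
      also have "\<dots> \<le> Suc (card (assigned I \<mu> j - D))"
        by (rule card_insert_le_m1) auto
      finally show ?thesis using room True by simp
    next
      case False
      have "assigned I \<nu> k \<subseteq> assigned I \<mu> k"
        using False by (auto simp: assigned_def \<nu>_def restrict_map_def split: if_splits)
      then have "card (assigned I \<nu> k) \<le> card (assigned I \<mu> k)"
        using fin by (rule card_mono[rotated])
      also have "\<dots> \<le> q k" using assms(2) k by (simp add: feasible_def)
      finally show ?thesis .
    qed
  qed
  show "ord_class.lexordp (ranked_utilities I u \<mu>) (ranked_utilities I u \<nu>)"
  proof (rule ranked_utilities_less[OF assms(1,3)])
    show "utility u \<mu> i < utility u \<nu> i"
      using assms(5) by (simp add: utility_def \<nu>_def)
    fix k assume "k \<in> I" "k \<noteq> i"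
    then show "utility u \<nu> k = utility u \<mu> k \<or>
        utility u \<mu> k < utility u \<nu> i \<and> utility u \<nu> k < utility u \<nu> i"
      \<comment> \<open>A dropped student falls from \<open>u k j\<close> to
        \<open>-\<infinity>\<close>, both below the new utility of \<open>i\<close>; the remaining
        students keep theirs.\<close>
      using D by (cases "k \<in> D") (auto simp: utility_def \<nu>_def assigned_def)
  qed
qed

section \<open>Stability and existence of lexicographic maxima\<close>

text \<open>A blocking pair yields a strict improvement, with \<open>D\<close> empty if the school
  has a free seat and \<open>D\<close> the singleton of a worse occupant if it is full.\<close>

lemma lex_maximal_imp_stable:
  assumes "finite I" "lex_maximal I J q u \<mu>"
  shows "stable_allocation I J q u \<mu>"
proof -
  have feas: "feasible I J q \<mu>"
    and max: "\<And>\<nu>. feasible I J q \<nu> \<Longrightarrow>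
      ord_class.lexordp_eq (ranked_utilities I u \<nu>) (ranked_utilities I u \<mu>)"
    using assms(2) by (auto simp: lex_maximal_def)
  have no_improvement: False
    if blocking: "i \<in> I" "j \<in> J" "utility u \<mu> i < ereal (u i j)" "D \<subseteq> assigned I \<mu> j"
      "\<And>k. k \<in> D \<Longrightarrow> u k j < u i j" "card (assigned I \<mu> j - D) < q j" for i j D
  proof -
    obtain \<nu> where "feasible I J q \<nu>"
      "ord_class.lexordp (ranked_utilities I u \<mu>) (ranked_utilities I u \<nu>)"
      by (rule feasible_improvement[OF assms(1) feas blocking])
    then show False
      using max[of \<nu>] lexordp_conv_lexordp_eq by blast
  qed
  have "\<not> (card (assigned I \<mu> j) < q j \<or>
          card (assigned I \<mu> j) = q j \<and> (\<exists>i'\<in>assigned I \<mu> j. u i' j < u i j))"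
    if ij: "i \<in> I" "j \<in> J" "utility u \<mu> i < ereal (u i j)" for i j
  proof
    assume "card (assigned I \<mu> j) < q j \<or>
          card (assigned I \<mu> j) = q j \<and> (\<exists>i'\<in>assigned I \<mu> j. u i' j < u i j)"
    then show False
    proof (elim disjE conjE bexE)
      assume "card (assigned I \<mu> j) < q j"
      then show False using no_improvement[OF ij, of "{}"] by simp
    next
      fix i' assume i': "card (assigned I \<mu> j) = q j" "i' \<in> assigned I \<mu> j" "u i' j < u i j"
      have "finite (assigned I \<mu> j)" using assms(1) by (simp add: assigned_def)
      then have "card (assigned I \<mu> j - {i'}) < q j"
        using i'(1,2) by (metis card_Diff1_less)
      then show False using no_improvement[OF ij, of "{i'}"] i' by simp
    qed
  qed
  then show ?thesis using feas unfolding stable_allocation_def by blast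
qed

lemma finite_feasible:
  assumes "finite I" "finite J"
  shows "finite {\<mu>. feasible I J q \<mu>}"
proof (rule finite_subset)
  show "{\<mu>. feasible I J q \<mu>} \<subseteq> (\<Union>A\<in>Pow I. {\<mu>. dom \<mu> = A \<and> ran \<mu> \<subseteq> J})"
    by (auto simp: feasible_def)
  show "finite (\<Union>A\<in>Pow I. {\<mu>. dom \<mu> = A \<and> ran \<mu> \<subseteq> J})"
    using assms by (auto intro: finite_set_of_finite_maps finite_subset)
qed

lemma lex_maximal_exists:
  fixes u :: "'i \<Rightarrow> 'j \<Rightarrow> real"
  assumes "finite I" "finite J"
  shows "\<exists>\<mu>. lex_maximal I J q u \<mu>"
proof -
  \<comment> \<open>The interpretation supplies \<open>L.Max\<close> for lists under the
    lexicographic order; the maximum is then taken over the finitely many feasible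
    allocations.\<close>
  interpret L: linorder "ord_class.lexordp_eq :: ereal list \<Rightarrow> ereal list \<Rightarrow> bool"
    "ord_class.lexordp"
    by (rule lexordp_linorder)
  let ?F = "{\<mu>. feasible I J q \<mu>}"
  have "feasible I J q Map.empty" by (simp add: feasible_def assigned_def)
  then have "L.Max (ranked_utilities I u ` ?F) \<in> ranked_utilities I u ` ?F"
    using finite_feasible[OF assms] by (intro L.Max_in) auto
  then obtain \<mu> where "feasible I J q \<mu>"
    "L.Max (ranked_utilities I u ` ?F) = ranked_utilities I u \<mu>" by auto
  then have "lex_maximal I J q u \<mu>"
    using finite_feasible[OF assms, of q] L.Max_ge[of "ranked_utilities I u ` ?F"]
    by (auto simp: lex_maximal_def)
  then show ?thesis by blast
qed

section \<open>Uniqueness of the stable allocation\<close>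

text \<open>Under \<open>\<nu>\<close>, student \<open>i\<close> would rather be at
  \<open>j\<close>. If the pair did not block, \<open>j\<close> would be full with students better
  than \<open>i\<close>. Their pairs lie above the best disagreement and so belong to
  \<open>\<mu>\<close> too, which then seats all of them and \<open>i\<close> at \<open>j\<close>,
  one more than the capacity.\<close>

lemma not_stable_if_extra_best_pair:
  assumes "finite I" "feasible I J q \<mu>" "feasible I J q \<nu>"
    and same_school: "\<And>i i' j. \<lbrakk>i \<in> I; i' \<in> I; j \<in> J; i \<noteq> i'\<rbrakk> \<Longrightarrow> u i j \<noteq> u i' j"
    and same_student: "\<And>i j j'. \<lbrakk>i \<in> I; j \<in> J; j' \<in> J; j \<noteq> j'\<rbrakk> \<Longrightarrow> u i j \<noteq> u i j'"
    and ij: "\<mu> i = Some j" "\<nu> i \<noteq> Some j"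
    and best: "\<And>i' j'. (\<mu> i' = Some j') \<noteq> (\<nu> i' = Some j') \<Longrightarrow> u i' j' \<le> u i j"
  shows "\<not> stable_allocation I J q u \<nu>"
proof
  assume stable: "stable_allocation I J q u \<nu>"
  have i: "i \<in> I" and j: "j \<in> J"
    using assms(2) ij(1) by (auto simp: feasible_def ran_def)
  have "utility u \<nu> i < ereal (u i j)"
  proof (cases "\<nu> i")
    case (Some j')
    then have "j' \<in> J" using assms(3) by (auto simp: feasible_def ran_def)
    then have "u i j' \<noteq> u i j" using same_student[OF i, of j' j] j ij(2) Some by auto
    \<comment> \<open>The pair of \<open>i\<close> and \<open>j'\<close> is itself a disagreement,
      since \<open>\<mu>\<close> sends \<open>i\<close> to \<open>j\<close>;
      \<open>same_student\<close> makes the inequality strict.\<close>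
    moreover have "u i j' \<le> u i j" using best[of i j'] ij Some by auto
    ultimately show ?thesis using Some by (simp add: utility_def)
  qed (simp add: utility_def)
  then have "\<not> card (assigned I \<nu> j) < q j"
    and nb: "card (assigned I \<nu> j) = q j \<Longrightarrow> i' \<in> assigned I \<nu> j \<Longrightarrow> \<not> u i' j < u i j" for i'
    using stable i j by (auto simp: stable_allocation_def)
  then have full: "card (assigned I \<nu> j) = q j"
    using assms(3) j by (force simp: feasible_def)
  have "insert i (assigned I \<nu> j) \<subseteq> assigned I \<mu> j"
  proof
    fix k assume "k \<in> insert i (assigned I \<nu> j)"
    then show "k \<in> assigned I \<mu> j"
    proof
      assume "k = i"
      then show ?thesis using i ij by (simp add: assigned_def)
    next
      assume k: "k \<in> assigned I \<nu> j"
      then have kI: "k \<in> I" "\<nu> k = Some j" by (auto simp: assigned_def)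
      then have "k \<noteq> i" using ij by auto
      then have "u i j < u k j"
        using nb[OF full k] same_school[OF kI(1) i j] by force
      \<comment> \<open>Otherwise \<open>k\<close> and \<open>j\<close> would form a disagreement of
        utility above the maximum.\<close>
      then have "\<mu> k = Some j" using best[of k j] kI(2) by force
      then show ?thesis using kI by (simp add: assigned_def)
    qed
  qed
  then have "card (insert i (assigned I \<nu> j)) \<le> card (assigned I \<mu> j)"
    using assms(1) by (intro card_mono) (auto simp: assigned_def)
  moreover have "i \<notin> assigned I \<nu> j" "finite (assigned I \<nu> j)"
    using ij assms(1) by (auto simp: assigned_def)
  moreover have "card (assigned I \<mu> j) \<le> q j" using assms(2) j by (simp add: feasible_def)
  ultimately show False using full by simp
qed

text \<open>Whichever allocation contains the best pair of disagreement takes the role of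
  \<open>\<mu>\<close> in the preceding lemma, which refutes stability of the other one.\<close>

lemma stable_unique:
  assumes "finite I" "finite J"
    and same_school: "\<And>i i' j. \<lbrakk>i \<in> I; i' \<in> I; j \<in> J; i \<noteq> i'\<rbrakk> \<Longrightarrow> u i j \<noteq> u i' j"
    and same_student: "\<And>i j j'. \<lbrakk>i \<in> I; j \<in> J; j' \<in> J; j \<noteq> j'\<rbrakk> \<Longrightarrow> u i j \<noteq> u i j'"
    and stable: "stable_allocation I J q u \<mu>" "stable_allocation I J q u \<nu>"
  shows "\<mu> = \<nu>"
proof (rule ccontr)
  assume ne: "\<mu> \<noteq> \<nu>"
  \<comment> \<open>\<open>P\<close> is the symmetric difference of the graphs of the two
    allocations; feasibility places it inside \<open>I \<times> J\<close>, so it is finite.\<close>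
  define P where "P = {(i, j). (\<mu> i = Some j) \<noteq> (\<nu> i = Some j)}"
  have feas: "feasible I J q \<mu>" "feasible I J q \<nu>"
    using stable by (auto simp: stable_allocation_def)
  then have "P \<subseteq> I \<times> J" by (auto simp: P_def feasible_def ran_def)
  then have "finite P" using assms(1,2) by (meson finite_SigmaI finite_subset)
  moreover have "P \<noteq> {}"
  proof -
    obtain i where "\<mu> i \<noteq> \<nu> i" using ne by blast
    then obtain j where "(\<mu> i = Some j) \<noteq> (\<nu> i = Some j)"
      by (metis not_Some_eq)
    then show ?thesis by (auto simp: P_def)
  qed
  ultimately have "Max (case_prod u ` P) \<in> case_prod u ` P"
    and ge: "\<And>p. p \<in> P \<Longrightarrow> case_prod u p \<le> Max (case_prod u ` P)" by auto
  then obtain i j where ij: "(i, j) \<in> P" "Max (case_prod u ` P) = u i j" by auto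
  have best: "u i' j' \<le> u i j" if "(\<mu> i' = Some j') \<noteq> (\<nu> i' = Some j')" for i' j'
    using ge[of "(i', j')"] that ij(2) by (simp add: P_def)
  consider "\<mu> i = Some j" "\<nu> i \<noteq> Some j" | "\<nu> i = Some j" "\<mu> i \<noteq> Some j"
    using ij(1) by (auto simp: P_def)
  then show False
  proof cases
    case 1
    have "\<not> stable_allocation I J q u \<nu>"
    proof (rule not_stable_if_extra_best_pair[where \<mu> = \<mu> and \<nu> = \<nu> and i = i and j = j])
      show "u i' j' \<le> u i j" if "(\<mu> i' = Some j') \<noteq> (\<nu> i' = Some j')" for i' j'
        using that best by metis
    qed (fact assms feas 1)+
    then show False using stable(2) by contradiction
  next
    case 2
    have "\<not> stable_allocation I J q u \<mu>"
    proof (rule not_stable_if_extra_best_pair[where \<mu> = \<nu> and \<nu> = \<mu> and i = i and j = j])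
      show "u i' j' \<le> u i j" if "(\<nu> i' = Some j') \<noteq> (\<mu> i' = Some j')" for i' j'
        using that best by metis
    qed (fact assms feas 2)+
    then show False using stable(1) by contradiction
  qed
qed

section \<open>Stability of the output of the algorithm\<close>

text \<open>
  The last but one clause holds because every remaining student competed for each seat already
  given away; it is what makes the last clause survive a step.
\<close>

definition mml_invariant ::
  "'i set \<Rightarrow> 'j set \<Rightarrow> ('j \<Rightarrow> nat) \<Rightarrow> ('i \<Rightarrow> 'j \<Rightarrow> real) \<Rightarrow>
   'i set \<Rightarrow> ('j \<Rightarrow> nat) \<Rightarrow> ('i \<rightharpoonup> 'j) \<Rightarrow> bool" where
  "mml_invariant I J q u R c \<mu> \<longleftrightarrow>
     R \<subseteq> I \<and> dom \<mu> = I - R \<and> ran \<mu> \<subseteq> J \<and>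
     (\<forall>j\<in>J. card (assigned I \<mu> j) + c j = q j) \<and>
     (\<forall>i j k. \<mu> i = Some j \<and> k \<in> R \<longrightarrow> u k j \<le> u i j) \<and>
     (\<forall>i j j'. \<mu> i = Some j \<and> j' \<in> J \<and> u i j < u i j' \<longrightarrow>
        c j' = 0 \<and> (\<forall>k. \<mu> k = Some j' \<longrightarrow> u i j' \<le> u k j'))"

text \<open>The chosen pair is maximal over remaining students and open schools. Hence no remaining
  student beats \<open>i\<close> at \<open>j\<close>, and every school that \<open>i\<close> prefers
  to \<open>j\<close> is already full.\<close>

lemma mml_reachable_invariant:
  assumes "mml_reachable I J q u R c \<mu>" "finite I"
  shows "mml_invariant I J q u R c \<mu>"
  using assms(1)
proof induction
  case init
  then show ?case by (simp add: mml_invariant_def assigned_def)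
next
  case (step R c \<mu> i j)
  note ij = step.hyps(2-4)
  have inv: "R \<subseteq> I" "dom \<mu> = I - R" "ran \<mu> \<subseteq> J"
    "\<And>j. j \<in> J \<Longrightarrow> card (assigned I \<mu> j) + c j = q j"
    "\<And>i j k. \<mu> i = Some j \<Longrightarrow> k \<in> R \<Longrightarrow> u k j \<le> u i j"
    "\<And>i j j'. \<mu> i = Some j \<Longrightarrow> j' \<in> J \<Longrightarrow> u i j < u i j' \<Longrightarrow> c j' = 0"
    "\<And>i j j' k. \<mu> i = Some j \<Longrightarrow> j' \<in> J \<Longrightarrow> u i j < u i j' \<Longrightarrow> \<mu> k = Some j' \<Longrightarrow> u i j' \<le> u k j'"
    using step.IH unfolding mml_invariant_def by blast+
  have \<mu>i: "\<mu> i = None" using inv(2) ij(1) by auto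
  have iI: "i \<in> I" using inv(1) ij(1) by auto
  let ?\<mu> = "\<mu>(i \<mapsto> j)" and ?c = "c(j := c j - 1)"
  have "dom ?\<mu> = I - (R - {i})" using inv(2) iI by auto
  moreover have "ran ?\<mu> \<subseteq> J" using inv(3) ij(2) \<mu>i by simp
  moreover have "card (assigned I ?\<mu> k) + ?c k = q k" if "k \<in> J" for k
  proof (cases "k = j")
    case True
    have "assigned I ?\<mu> j = insert i (assigned I \<mu> j)" "i \<notin> assigned I \<mu> j"
      using iI \<mu>i by (auto simp: assigned_def)
    moreover have "finite (assigned I \<mu> j)" using assms(2) by (simp add: assigned_def)
    \<comment> \<open>As \<open>c j \<noteq> 0\<close>, the natural subtraction does not truncate:
      the seat lost by \<open>c\<close> is the one gained by \<open>j\<close>.\<close>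
    ultimately show ?thesis using inv(4)[OF ij(2)] ij(3) True by simp
  next
    case False
    then have "assigned I ?\<mu> k = assigned I \<mu> k" using \<mu>i by (auto simp: assigned_def)
    then show ?thesis using inv(4)[OF that] False by simp
  qed
  moreover have "u k j' \<le> u i' j'" if "?\<mu> i' = Some j'" "k \<in> R - {i}" for i' j' k
    using that inv(5) step.hyps(5)[of k j] ij by (auto split: if_splits)
  moreover have "?c k = 0 \<and> (\<forall>m. ?\<mu> m = Some k \<longrightarrow> u i' k \<le> u m k)"
    if "?\<mu> i' = Some j'" "k \<in> J" "u i' j' < u i' k" for i' j' k
  proof -
    have "c k = 0 \<and> (\<forall>m. \<mu> m = Some k \<longrightarrow> u i' k \<le> u m k)"
    proof (cases "i' = i")
      case True
      \<comment> \<open>An open school preferred by \<open>i\<close> would beat the maximal pair.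
        The occupants of \<open>k\<close> rank at least as high as \<open>i\<close> because
        \<open>i\<close> was still in \<open>R\<close>.\<close>
      then have "c k = 0" using that step.hyps(5)[of i k] ij(1) by force
      then show ?thesis using inv(5) ij(1) True by blast
    next
      case False
      then show ?thesis using that inv(6,7) by (metis fun_upd_apply)
    qed
    \<comment> \<open>School \<open>k\<close> was full before the step and \<open>j\<close> was
      open, so the step changes neither the capacity nor the occupants of \<open>k\<close>.\<close>
    moreover from this have "k \<noteq> j" using ij(3) by auto
    ultimately show ?thesis by auto
  qed
  ultimately show ?case using inv(1) unfolding mml_invariant_def by blast
qed

text \<open>The invariant shows that a school some student would rather attend is full of students
  at least as good there, which rules out both kinds of blocking.\<close>

lemma mml_output_stable:
  assumes "finite I" "mml_output I J q u \<mu>"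
  shows "stable_allocation I J q u \<mu>"
proof -
  obtain R c where "mml_reachable I J q u R c \<mu>" and fin: "R = {} \<or> (\<forall>j\<in>J. c j = 0)"
    using assms(2) unfolding mml_output_def by blast
  then have "mml_invariant I J q u R c \<mu>" using mml_reachable_invariant assms(1) by blast
  then have inv: "dom \<mu> = I - R" "ran \<mu> \<subseteq> J"
    "\<And>j. j \<in> J \<Longrightarrow> card (assigned I \<mu> j) + c j = q j"
    "\<And>i j k. \<mu> i = Some j \<Longrightarrow> k \<in> R \<Longrightarrow> u k j \<le> u i j"
    "\<And>i j j'. \<mu> i = Some j \<Longrightarrow> j' \<in> J \<Longrightarrow> u i j < u i j' \<Longrightarrow> c j' = 0"
    "\<And>i j j' k. \<mu> i = Some j \<Longrightarrow> j' \<in> J \<Longrightarrow> u i j < u i j' \<Longrightarrow> \<mu> k = Some j' \<Longrightarrow> u i j' \<le> u k j'"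
    unfolding mml_invariant_def by blast+
  have "feasible I J q \<mu>"
    unfolding feasible_def using inv(1-3) by (metis Diff_subset le_add1)
  moreover have "card (assigned I \<mu> j) = q j \<and> (\<forall>k\<in>assigned I \<mu> j. u i j \<le> u k j)"
    if "i \<in> I" "j \<in> J" "utility u \<mu> i < ereal (u i j)" for i j
  proof -
    have "c j = 0 \<and> (\<forall>k. \<mu> k = Some j \<longrightarrow> u i j \<le> u k j)"
    proof (cases "\<mu> i")
      case None
      \<comment> \<open>An unassigned student is still in \<open>R\<close>, so the loop ended
        because all capacities were exhausted.\<close>
      then have "i \<in> R" using inv(1) that(1) by auto
      then show ?thesis using fin inv(4) that(2) by blast
    next
      case (Some j')
      then have "u i j' < u i j" using that(3) by (simp add: utility_def)
      then show ?thesis using inv(5,6) Some that(2) by blast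
    qed
    then show ?thesis using inv(3)[OF that(2)] by (auto simp: assigned_def)
  qed
  ultimately show ?thesis
    unfolding stable_allocation_def by (metis less_irrefl not_less)
qed

theorem theorem2p1:
  fixes I :: "'i set" and J :: "'j set"
    and q :: "'j \<Rightarrow> nat" and u :: "'i \<Rightarrow> 'j \<Rightarrow> real"
  assumes "finite I" and "finite J" and "card J \<le> card I"
    and "\<And>i j. \<lbrakk>i \<in> I; j \<in> J\<rbrakk> \<Longrightarrow> u i j > 0"
    and "\<And>i i' j. \<lbrakk>i \<in> I; i' \<in> I; j \<in> J; i \<noteq> i'\<rbrakk> \<Longrightarrow> u i j \<noteq> u i' j"
    and "\<And>i j j'. \<lbrakk>i \<in> I; j \<in> J; j' \<in> J; j \<noteq> j'\<rbrakk> \<Longrightarrow> u i j \<noteq> u i j'"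
  shows "(\<forall>\<mu>. mml_output I J q u \<mu> \<longrightarrow> lex_maximal I J q u \<mu>)
       \<and> (\<forall>\<mu>. mml_output I J q u \<mu> \<longrightarrow> stable_allocation I J q u \<mu>)
       \<and> (\<exists>!\<mu>. stable_allocation I J q u \<mu>)"
proof -
  obtain \<nu> where max: "lex_maximal I J q u \<nu>"
    using lex_maximal_exists[OF assms(1,2)] by blast
  have stable: "stable_allocation I J q u \<nu>"
    using lex_maximal_imp_stable[OF assms(1) max] .
  have unique: "\<mu> = \<nu>" if "stable_allocation I J q u \<mu>" for \<mu>
    using stable_unique[OF assms(1,2,5,6) that stable] .
  have "stable_allocation I J q u \<mu>" if "mml_output I J q u \<mu>" for \<mu>
    using mml_output_stable[OF assms(1) that] .
  then show ?thesis using max stable unique by blast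
qed

end
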